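(* For every nonempty initial segment $\mathcal{D}$ of the binary order on $\mathcal{B}(n)$, $$\frac{w(\mathcal{D})}{|\mathcal{D}|} \ \ge\ \frac{w(\mathcal{B}(n))}{|\mathcal{B}(n)|} = \frac{\binom{n}{\lfloor n/2\rfloor}}{2^n}.$$
   Context: $\mathcal{B}(n)$ is the family of all subsets of $[n]=\{1,\dots,n\}$ ordered by inclusion. The binary order $<_b$: $A <_b B$ if $\max(A\triangle B) \in B$; its initial segments are downsets, called binary downsets. The width $w(\mathcal{X})$ is the maximum size of an antichain (with respect to inclusion) in $\mathcal{X}$. *)

theory Defs
  imports Complex_Main
begin

definition boolean_lattice :: "nat \<Rightarrow> nat set set" where
  "boolean_lattice n = Pow {1..n}"

(* The conjunct A \<noteq> B is needed because Max {} is an unspecified number. *)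
definition binary_less :: "nat set \<Rightarrow> nat set \<Rightarrow> bool" (infix "<\<^sub>b" 50) where
  "A <\<^sub>b B \<longleftrightarrow> A \<noteq> B \<and> Max (sym_diff A B) \<in> B"

definition binary_initial_segment :: "nat \<Rightarrow> nat set set \<Rightarrow> bool" where
  "binary_initial_segment n D \<longleftrightarrow>
     D \<subseteq> boolean_lattice n \<and>
     (\<forall>B \<in> D. \<forall>A \<in> boolean_lattice n. A <\<^sub>b B \<longrightarrow> A \<in> D)"

definition antichain :: "'a set set \<Rightarrow> bool" where
  "antichain F \<longleftrightarrow> (\<forall>A \<in> F. \<forall>B \<in> F. A \<subseteq> B \<longrightarrow> A = B)"

(* The maximum is over a nonempty finite set, hence meaningful, whenever X is finite. *)
definition width :: "'a set set \<Rightarrow> nat" where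
  "width X = Max {card F | F. F \<subseteq> X \<and> antichain F}"

end

theory Submission
  imports Defs
begin

text \<open>
  Replacing the members of maximal size of an antichain in a downset by their shadow gives an
  antichain in the same downset, and double counting shows that nothing is lost as long as this
  size exceeds half the size of the ground set. Doing this first to an antichain and
  then to the complements of the result brings everything to one level, which is Sperner's theorem. For the lower bound, an initial segment of
  \<open>\<B>(N + 1)\<close> that is not contained in \<open>\<B>(N)\<close> is \<open>\<B>(N)\<close> together with
  a copy of an initial segment \<open>D'\<close> of \<open>\<B>(N)\<close>, with \<open>N + 1\<close> added to each of its sets.
  By induction \<open>D'\<close> has a large antichain, which is pushed down below level
  \<open>\<lceil>N / 2\<rceil>\<close>; together with the full level \<open>\<lceil>N / 2\<rceil>\<close> of \<open>\<B>(N)\<close> it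
  forms an antichain. For odd \<open>N\<close> the pushing is free, and for \<open>N = 2 j\<close> it costs a
  factor \<open>j / (j + 1)\<close>, which is exactly what the step from \<open>2 j\<close> to \<open>2 j + 1\<close> affords.
\<close>

section \<open>Shadows, and pushing antichains down inside a downset\<close>

definition shadow :: "'a set set \<Rightarrow> 'a set set" where
  "shadow S = (\<Union>A\<in>S. (\<lambda>x. A - {x}) ` A)"

definition downset :: "'a set set \<Rightarrow> bool" where
  "downset D \<longleftrightarrow> (\<forall>B\<in>D. \<forall>A. A \<subseteq> B \<longrightarrow> A \<in> D)"

text \<open>Double counting: each \<open>A\<close> in \<open>S\<close> gives \<open>r\<close> pairs
  \<open>(A - {x}, x)\<close>, and such a pair determines \<open>A\<close>. A shadow set, of size
  \<open>r - 1\<close>, occurs in at most \<open>card V + 1 - r\<close> of them, since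
  \<open>x\<close> lies in \<open>V\<close> outside it.\<close>

lemma card_shadow:
  assumes "finite V" and "S \<subseteq> Pow V" and "\<forall>A\<in>S. card A = r"
  shows "r * card S \<le> (card V + 1 - r) * card (shadow S)"
proof -
  have finS: "finite S"
    using assms(1,2) by (simp add: finite_subset)
  have fin: "finite A" if "A \<in> S" for A
    using that assms(1,2) by (meson PowD finite_subset subsetD)
  have sub: "B \<subseteq> V" "card (V - B) = card V + 1 - r" if B: "B \<in> shadow S" for B
  proof -
    obtain A x where A: "A \<in> S" "x \<in> A" "B = A - {x}"
      using B by (auto simp: shadow_def)
    show *: "B \<subseteq> V" using A assms(2) by auto
    have "card A = r" "finite A" using A(1) fin assms(3) by auto
    \<comment> \<open>Positivity of \<open>r\<close> turns \<open>card V - (r - 1)\<close> into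
      \<open>card V + 1 - r\<close> under truncated subtraction.\<close>
    then have "card B = r - 1" "r > 0"
      using A(2,3) by (auto simp: card_gt_0_iff)
    moreover have "r \<le> card V"
      using A assms by (metis PowD card_mono subsetD)
    ultimately show "card (V - B) = card V + 1 - r"
      using * assms(1) by (simp add: card_Diff_subset finite_subset)
  qed
  have finsh: "finite (shadow S)"
    unfolding shadow_def using finS fin by auto
  have "r * card S = card (SIGMA A:S. A)"
    using finS fin assms(3) by (subst card_SigmaI) auto
  also have "\<dots> \<le> card (SIGMA B:shadow S. V - B)"
  proof (rule card_inj_on_le[where f = "\<lambda>(A, x). (A - {x}, x)"])
    show "inj_on (\<lambda>(A, x). (A - {x}, x)) (SIGMA A:S. A)"
      by (auto simp: inj_on_def)
    show "(\<lambda>(A, x). (A - {x}, x)) ` (SIGMA A:S. A) \<subseteq> (SIGMA B:shadow S. V - B)"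
      using assms(2) by (auto simp: shadow_def)
    show "finite (SIGMA B:shadow S. V - B)"
      using finsh assms(1) by blast
  qed
  also have "\<dots> = (card V + 1 - r) * card (shadow S)"
    using finsh assms(1) sub by (subst card_SigmaI) auto
  finally show ?thesis .
qed

text \<open>The members of size \<open>r\<close> give way to their shadow: \<open>q\<close> members
  stay, \<open>s\<close> leave and \<open>t\<close> enter. The inequality stays in raw form because
  it serves twice: above the middle it yields \<open>s \<le> t\<close>, at the middle it bounds the
  loss.\<close>

lemma antichain_push_level:
  assumes V: "finite V" and D: "D \<subseteq> Pow V" "downset D"
    and F: "F \<subseteq> D" "antichain F" "\<forall>A\<in>F. card A \<le> r"
  obtains G q s t where "G \<subseteq> D" "antichain G" "\<forall>A\<in>G. card A < r"
    "\<forall>A\<in>G. A \<in> F \<or> r \<le> card A + 1"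
    "card F = q + s" "card G = q + t" "r * s \<le> (card V + 1 - r) * t"
proof -
  define S where "S = {A \<in> F. card A = r}"
  have finD: "finite D"
    using V D by (simp add: finite_subset)
  have fin: "finite A" if "A \<in> D" for A
    using that V D by (meson PowD finite_subset subsetD)
  have low: "card A < r" if "A \<in> F - S" for A
    using that F(3) S_def by force
  have shE: "\<exists>B\<in>S. A \<subseteq> B \<and> A \<in> D \<and> card A + 1 = r" if A: "A \<in> shadow S" for A
  proof -
    obtain B x where B: "B \<in> S" "x \<in> B" "A = B - {x}"
      using A by (auto simp: shadow_def)
    then have BD: "B \<in> D" "card B = r" using S_def F(1) by auto
    have "A \<in> D" using BD B D(2) unfolding downset_def by blast
    moreover have "card A + 1 = r"
      using B BD fin by (metis Suc_eq_plus1 card_Suc_Diff1)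
    ultimately show ?thesis using B by blast
  qed
  \<comment> \<open>A shadow set lies inside a member of \<open>S\<close>, so a surviving
    \<open>A\<close> below it would be comparable to that member of \<open>F\<close>. In particular
    the two families are disjoint, so their cardinalities add up.\<close>
  have key: "\<not> A \<subseteq> B" if "A \<in> F - S" "B \<in> shadow S" for A B
    using shE[OF that(2)] that(1) F(2) unfolding antichain_def S_def
    by (metis (no_types, lifting) DiffE dual_order.trans mem_Collect_eq)
  have anti: "antichain ((F - S) \<union> shadow S)"
    unfolding antichain_def
  proof (intro ballI impI)
    fix A B assume AB: "A \<in> (F - S) \<union> shadow S" "B \<in> (F - S) \<union> shadow S" "A \<subseteq> B"
    show "A = B"
    proof (cases "A \<in> shadow S")
      case True
      have finB: "finite B" using AB(2) shE F(1) fin by blast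
      \<comment> \<open>A shadow set has size \<open>r - 1\<close>, the largest size left, so
        nothing in the new family can properly contain it.\<close>
      have "card B \<le> card A"
        using AB(2) shE[OF True] shE[of B] low[of B] by fastforce
      then show ?thesis using AB(3) finB by (simp add: card_seteq)
    next
      case False
      then show ?thesis using AB key F(2) unfolding antichain_def by blast
    qed
  qed
  have "finite F" using F(1) finD finite_subset by blast
  then have cF: "card F = card (F - S) + card S"
    using card_mono[of F S] by (simp add: card_Diff_subset S_def)
  have shD: "shadow S \<subseteq> D" using shE by blast
  have cG: "card ((F - S) \<union> shadow S) = card (F - S) + card (shadow S)"
    using key \<open>finite F\<close> finite_subset[OF shD finD] by (intro card_Un_disjoint) auto
  have "r * card S \<le> (card V + 1 - r) * card (shadow S)"
    using V D(1) F(1) by (intro card_shadow) (auto simp: S_def)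
  moreover have "(F - S) \<union> shadow S \<subseteq> D" using F(1) shD by blast
  moreover have "\<forall>A\<in>(F - S) \<union> shadow S. card A < r" using low shE by fastforce
  moreover have "\<forall>A\<in>(F - S) \<union> shadow S. A \<in> F \<or> r \<le> card A + 1" using shE by fastforce
  ultimately show ?thesis using that anti cF cG by blast
qed

text \<open>For \<open>r\<close> above the middle, \<open>card V + 1 - r \<le> r\<close>, so each
  push costs nothing and can be repeated. The bound \<open>l\<close> survives because new sets have
  size \<open>r - 1\<close>, at least the middle; with \<open>l\<close> equal to the middle only one
  level remains.\<close>

lemma antichain_push_to_middle:
  assumes V: "finite V" and D: "D \<subseteq> Pow V" "downset D"
    and F: "F \<subseteq> D" "antichain F" "\<forall>A\<in>F. l \<le> card A" and l: "l \<le> card V div 2"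
  shows "\<exists>G\<subseteq>D. antichain G \<and> (\<forall>A\<in>G. l \<le> card A \<and> card A \<le> card V div 2) \<and> card F \<le> card G"
proof -
  have "\<exists>G\<subseteq>D. antichain G \<and> (\<forall>A\<in>G. l \<le> card A \<and> card A \<le> card V div 2) \<and> card F \<le> card G"
    if "F \<subseteq> D" "antichain F" "\<forall>A\<in>F. l \<le> card A \<and> card A \<le> card V div 2 + k" for F k
    using that
  proof (induction k arbitrary: F)
    case 0
    then show ?case by auto
  next
    case (Suc k)
    define r where "r = card V div 2 + Suc k"
    obtain G q s t where G: "G \<subseteq> D" "antichain G" "\<forall>A\<in>G. card A < r"
      "\<forall>A\<in>G. A \<in> F \<or> r \<le> card A + 1"
      and c: "card F = q + s" "card G = q + t" "r * s \<le> (card V + 1 - r) * t"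
    proof (rule antichain_push_level[OF V D Suc.prems(1,2)])
      show "\<forall>A\<in>F. card A \<le> r" using Suc.prems(3) by (simp add: r_def)
    qed
    have "(card V + 1 - r) * t \<le> r * t"
      unfolding r_def by (intro mult_le_mono1) linarith
    then have "r * s \<le> r * t" using c(3) by linarith
    moreover have "0 < r" by (simp add: r_def)
    ultimately have "card F \<le> card G" using c(1,2) by simp
    moreover have "\<forall>A\<in>G. l \<le> card A \<and> card A \<le> card V div 2 + k"
      using G(3,4) Suc.prems(3) l r_def by fastforce
    ultimately show ?case using Suc.IH[OF G(1,2)] by (meson order_trans)
  qed
  \<comment> \<open>No subset of \<open>V\<close> has more than \<open>card V\<close> elements, so
    the excess \<open>k = card V\<close> covers every \<open>F\<close>.\<close>
  moreover have "\<forall>A\<in>F. l \<le> card A \<and> card A \<le> card V div 2 + card V"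
    using F(1,3) D(1) V by (meson Pow_iff card_mono subsetD trans_le_add2)
  ultimately show ?thesis using F by blast
qed

section \<open>Sperner's theorem and the width of the Boolean lattice\<close>

lemma antichain_level: "finite V \<Longrightarrow> antichain {A. A \<subseteq> V \<and> card A = k}"
  unfolding antichain_def by (metis (mono_tags, lifting) card_subset_eq finite_subset mem_Collect_eq)

theorem Sperner:
  assumes V: "finite V" and F: "F \<subseteq> Pow V" "antichain F"
  shows "card F \<le> card V choose (card V div 2)"
proof -
  have down: "downset (Pow V)" by (auto simp: downset_def)
  obtain G where G: "G \<subseteq> Pow V" "antichain G" "\<forall>A\<in>G. card A \<le> card V div 2" "card F \<le> card G"
    using antichain_push_to_middle[OF V order_refl down F, of 0] by auto
  \<comment> \<open>Complementation reverses inclusion, so it keeps antichains and turns the upper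
    bound on sizes into a lower one.\<close>
  define H where "H = (\<lambda>A. V - A) ` G"
  have inj: "inj_on (\<lambda>A. V - A) G"
    using G(1) by (intro inj_onI) blast
  have H: "H \<subseteq> Pow V" "antichain H"
  proof -
    show "H \<subseteq> Pow V" by (auto simp: H_def)
    have "A = B" if "A \<in> G" "B \<in> G" "V - A \<subseteq> V - B" for A B
    proof -
      have "B \<subseteq> A" using that G(1) by blast
      then show ?thesis using that G(2) unfolding antichain_def by blast
    qed
    then show "antichain H" unfolding H_def antichain_def by blast
  qed
  have "\<forall>A\<in>H. card V div 2 \<le> card A"
    using G(1,3) V by (fastforce simp: H_def card_Diff_subset finite_subset)
  \<comment> \<open>With \<open>l\<close> set to the middle, the second push leaves sets of exactly
    that size.\<close>
  then obtain K where K: "K \<subseteq> Pow V" "\<forall>A\<in>K. card A = card V div 2" "card H \<le> card K"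
    using antichain_push_to_middle[OF V order_refl down H, of "card V div 2"]
    by (metis dual_order.antisym order_refl)
  have "card K \<le> card {A. A \<subseteq> V \<and> card A = card V div 2}"
    using K V by (intro card_mono) auto
  then show ?thesis
    using G(4) K(3) n_subsets[OF V] card_image[OF inj] by (simp add: H_def)
qed

lemma width_ge:
  assumes "finite X" and "F \<subseteq> X" and "antichain F"
  shows "card F \<le> width X"
  unfolding width_def
proof (rule Max_ge)
  show "finite {card F |F. F \<subseteq> X \<and> antichain F}"
    using assms(1) by (simp add: setcompr_eq_image)
qed (use assms in blast)

lemma width_le:
  assumes "finite X" and "\<And>F. F \<subseteq> X \<Longrightarrow> antichain F \<Longrightarrow> card F \<le> m"
  shows "width X \<le> m"
  unfolding width_def
proof (rule Max.boundedI)
  show "finite {card F |F. F \<subseteq> X \<and> antichain F}"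
    using assms(1) by (simp add: setcompr_eq_image)
  have "antichain {}" by (simp add: antichain_def)
  then show "{card F |F. F \<subseteq> X \<and> antichain F} \<noteq> {}" by blast
qed (use assms(2) in blast)

lemma width_boolean_lattice: "width (boolean_lattice n) = n choose (n div 2)"
proof (rule antisym)
  show "width (boolean_lattice n) \<le> n choose (n div 2)"
    using Sperner[of "{1..n}"] by (intro width_le) (auto simp: boolean_lattice_def)
  have "card {A. A \<subseteq> {1..n} \<and> card A = n div 2} \<le> width (boolean_lattice n)"
    by (intro width_ge antichain_level) (auto simp: boolean_lattice_def)
  then show "n choose (n div 2) \<le> width (boolean_lattice n)"
    by (simp add: n_subsets)
qed

section \<open>Structure of the initial segments of the binary order\<close>

text \<open>The binary order extends inclusion: if \<open>A\<close> is a proper subset of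
  \<open>B\<close>, then \<open>sym_diff A B\<close> is \<open>B - A\<close>, whose maximum lies in
  \<open>B\<close>.\<close>

lemma binary_initial_segment_downset:
  assumes "binary_initial_segment n D"
  shows "downset D"
  unfolding downset_def
proof (intro ballI allI impI)
  fix A B assume AB: "B \<in> D" "A \<subseteq> B"
  have B: "B \<subseteq> {1..n}"
    using assms AB(1) by (auto simp: binary_initial_segment_def boolean_lattice_def)
  show "A \<in> D"
  proof (cases "A = B")
    case False
    have "Max (B - A) \<in> B - A"
      using AB(2) False B by (intro Max_in) (auto intro: finite_subset)
    moreover have "sym_diff A B = B - A" using AB(2) by blast
    ultimately have "A <\<^sub>b B" using False by (simp add: binary_less_def)
    moreover have "A \<in> boolean_lattice n" using AB(2) B by (auto simp: boolean_lattice_def)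
    ultimately show ?thesis using assms AB(1) by (auto simp: binary_initial_segment_def)
  qed (use AB in simp)
qed

lemma binary_initial_segment_finite: "binary_initial_segment n D \<Longrightarrow> finite D"
  unfolding binary_initial_segment_def boolean_lattice_def
  by (meson finite_Pow_iff finite_atLeastAtMost finite_subset)

text \<open>A single member containing \<open>Suc N\<close> exceeds every subset of
  \<open>{1..N}\<close>, as \<open>Suc N\<close> is then the maximum of the symmetric difference.
  Between two sets containing \<open>Suc N\<close> this element cancels, so deleting it leaves an
  initial segment one dimension lower.\<close>

lemma binary_initial_segment_Suc:
  assumes D: "binary_initial_segment (Suc N) D"
  obtains "binary_initial_segment N D"
  | D' where "binary_initial_segment N D'" "D = Pow {1..N} \<union> insert (Suc N) ` D'"
proof (cases "\<exists>B\<in>D. Suc N \<in> B")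
  case False
  then have "D \<subseteq> boolean_lattice N"
    using D by (fastforce simp: binary_initial_segment_def boolean_lattice_def atLeastAtMostSuc_conv)
  moreover have "boolean_lattice N \<subseteq> boolean_lattice (Suc N)"
    by (auto simp: boolean_lattice_def)
  ultimately have "binary_initial_segment N D"
    using D by (auto simp: binary_initial_segment_def)
  then show ?thesis by (rule that(1))
next
  case True
  then obtain B where B: "B \<in> D" "Suc N \<in> B" by blast
  have DS: "D \<subseteq> Pow {1..Suc N}"
    using D by (simp add: binary_initial_segment_def boolean_lattice_def)
  have closed: "A \<in> D" if "B \<in> D" "A \<subseteq> {1..Suc N}" "A <\<^sub>b B" for A B
    using that D by (auto simp: binary_initial_segment_def boolean_lattice_def)
  have low: "Pow {1..N} \<subseteq> D"
  proof
    fix A assume "A \<in> Pow {1..N}"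
    then have A: "A \<subseteq> {1..N}" by simp
    have "Max (sym_diff A B) = Suc N"
    proof (rule Max_eqI)
      have "sym_diff A B \<subseteq> {1..Suc N}" using A B DS by fastforce
      then show "finite (sym_diff A B)" "\<And>y. y \<in> sym_diff A B \<Longrightarrow> y \<le> Suc N"
        by (auto intro: finite_subset)
      show "Suc N \<in> sym_diff A B" using A B by auto
    qed
    then have "A <\<^sub>b B" using A B by (auto simp: binary_less_def)
    moreover have "A \<subseteq> {1..Suc N}" using A by auto
    ultimately show "A \<in> D" using closed B by blast
  qed
  define D' where "D' = {A \<in> Pow {1..N}. insert (Suc N) A \<in> D}"
  have "binary_initial_segment N D'"
    unfolding binary_initial_segment_def
  proof (intro conjI ballI impI)
    show "D' \<subseteq> boolean_lattice N" by (auto simp: D'_def boolean_lattice_def)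
    fix B A assume BA: "B \<in> D'" "A \<in> boolean_lattice N" "A <\<^sub>b B"
    then have sub: "A \<subseteq> {1..N}" "B \<subseteq> {1..N}" by (auto simp: D'_def boolean_lattice_def)
    then have nin: "Suc N \<notin> A" "Suc N \<notin> B" by auto
    then have "sym_diff (insert (Suc N) A) (insert (Suc N) B) = sym_diff A B" by auto
    then have "insert (Suc N) A <\<^sub>b insert (Suc N) B"
      using BA(3) nin by (auto simp: binary_less_def insert_ident)
    moreover have "insert (Suc N) A \<subseteq> {1..Suc N}" using sub by auto
    ultimately have "insert (Suc N) A \<in> D" using closed BA(1) D'_def by blast
    then show "A \<in> D'" using sub D'_def by blast
  qed
  moreover have "D = Pow {1..N} \<union> insert (Suc N) ` D'"
  proof (intro equalityI subsetI)
    fix A assume A: "A \<in> D"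
    show "A \<in> Pow {1..N} \<union> insert (Suc N) ` D'"
    proof (cases "Suc N \<in> A")
      case True
      then have "A = insert (Suc N) (A - {Suc N})" by blast
      moreover have "A - {Suc N} \<subseteq> {1..N}"
        using A DS by (auto simp: atLeastAtMostSuc_conv)
      ultimately show ?thesis using A unfolding D'_def
        by (metis (mono_tags, lifting) PowI UnI2 imageI mem_Collect_eq)
    next
      case False
      then show ?thesis using A DS by (fastforce simp: atLeastAtMostSuc_conv)
    qed
  qed (use low D'_def in blast)
  ultimately show ?thesis by (rule that(2))
qed

section \<open>Joining a full level to a lifted antichain\<close>

text \<open>Sets of the level avoid \<open>z\<close> and so contain no lifted set. Conversely, a
  level set inside \<open>insert z B\<close> would lie inside \<open>B\<close>, which has fewer than
  \<open>k\<close> elements.\<close>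

lemma antichain_level_Un_insert:
  assumes V: "finite V" "z \<notin> V" and G: "G \<subseteq> Pow V" "antichain G" "\<forall>A\<in>G. card A < k"
  shows "antichain ({A. A \<subseteq> V \<and> card A = k} \<union> insert z ` G)"
    and "card ({A. A \<subseteq> V \<and> card A = k} \<union> insert z ` G) = (card V choose k) + card G"
proof -
  let ?L = "{A. A \<subseteq> V \<and> card A = k}"
  have zG: "z \<notin> A" if "A \<in> G" for A using that V(2) G(1) by blast
  have up: "\<not> A \<subseteq> insert z B" if "A \<in> ?L" "B \<in> G" for A B
  proof
    assume "A \<subseteq> insert z B"
    then have "A \<subseteq> B" using that(1) V(2) by blast
    moreover have "finite B" using that(2) G(1) V(1) by (meson PowD finite_subset subsetD)
    ultimately have "card A \<le> card B" by (simp add: card_mono)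
    then show False using that G(3) by force
  qed
  show "antichain (?L \<union> insert z ` G)"
    unfolding antichain_def
  proof (intro ballI impI)
    fix A B assume AB: "A \<in> ?L \<union> insert z ` G" "B \<in> ?L \<union> insert z ` G" "A \<subseteq> B"
    consider "A \<in> ?L" "B \<in> ?L" | A' B' where "A' \<in> G" "B' \<in> G" "A = insert z A'" "B = insert z B'"
      using AB(1,2)
    proof (elim UnE imageE)
      fix A' assume "A' \<in> G" "A = insert z A'" "B \<in> ?L"
      then show thesis using AB(3) V(2) by blast
    next
      fix B' assume "A \<in> ?L" "B' \<in> G" "B = insert z B'"
      then show thesis using AB(3) up by blast
    qed (use that in blast)+
    then show "A = B"
    proof cases
      case 1
      then show ?thesis using antichain_level[OF V(1), of k] AB(3) unfolding antichain_def by blast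
    next
      case 2
      then have "A' \<subseteq> B'" using AB(3) zG by blast
      then show ?thesis using 2 G(2) unfolding antichain_def by blast
    qed
  qed
  have "inj_on (insert z) G" using zG by (intro inj_onI) (metis insert_ident)
  moreover have "finite ?L" "finite G" using V(1) G(1) by (auto simp: finite_subset)
  moreover have "?L \<inter> insert z ` G = {}" using V(2) by blast
  ultimately show "card (?L \<union> insert z ` G) = (card V choose k) + card G"
    by (simp add: card_Un_disjoint card_image n_subsets V(1))
qed

section \<open>Growth of the central binomial coefficients\<close>

text \<open>For a positive lower index, Pascal's rule writes the left side as two entries of row
  \<open>N\<close>, each at most the central one.\<close>

lemma central_binomial_Suc_le: "Suc N choose (Suc N div 2) \<le> 2 * (N choose (N div 2))"
proof (cases "Suc N div 2")
  case (Suc k)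
  then show ?thesis
    using binomial_maximum[of N k] binomial_maximum[of N "Suc k"] by simp
qed (use binomial_maximum[of N 0] in simp)

lemma central_binomial_odd_symmetric: "(2 * j + 1) choose j = (2 * j + 1) choose (j + 1)"
  using binomial_symmetric[of j "2 * j + 1"] by simp

text \<open>The growth factor \<open>(2 * j + 1) / (j + 1)\<close> falls short of 2; this slack pays
  for the push at the middle level.\<close>

lemma central_binomial_odd: "(j + 1) * ((2 * j + 1) choose j) = (2 * j + 1) * ((2 * j) choose j)"
  unfolding central_binomial_odd_symmetric
  using Suc_times_binomial_eq[of "2 * j" j] by (simp add: mult.commute)

text \<open>Here the coefficient exactly doubles, which leaves no slack: the step from odd
  \<open>N\<close> must lose nothing.\<close>

lemma central_binomial_even: "(2 * j + 2) choose (j + 1) = 2 * ((2 * j + 1) choose (j + 1))"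
proof -
  have "(2 * j + 2) choose (j + 1) = ((2 * j + 1) choose j) + ((2 * j + 1) choose (j + 1))"
    by (metis Suc_eq_plus1 add_2_eq_Suc' binomial_Suc_Suc)
  then show ?thesis using central_binomial_odd_symmetric[of j] by linarith
qed

section \<open>The induction on the dimension and the width bound\<close>

text \<open>The density bound with denominators cleared, so that the induction stays in the natural
  numbers. It speaks of an antichain instead of the width because the induction step pushes and
  lifts that antichain.\<close>

lemma binary_initial_segment_large_antichain:
  assumes "binary_initial_segment n D"
  shows "\<exists>F\<subseteq>D. antichain F \<and> card D * (n choose (n div 2)) \<le> 2 ^ n * card F"
  using assms
proof (induction n arbitrary: D)
  case 0
  then have "D \<subseteq> {{}}" by (simp add: binary_initial_segment_def boolean_lattice_def)
  then have "antichain D" by (auto simp: antichain_def)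
  then show ?case by auto
next
  case (Suc N)
  from Suc.prems show ?case
  proof (cases rule: binary_initial_segment_Suc)
    case 1
    from Suc.IH[OF this] obtain F where F: "F \<subseteq> D" "antichain F"
      "card D * (N choose (N div 2)) \<le> 2 ^ N * card F" by blast
    have "card D * (Suc N choose (Suc N div 2)) \<le> card D * (2 * (N choose (N div 2)))"
      by (intro mult_le_mono2 central_binomial_Suc_le)
    also have "\<dots> \<le> 2 ^ Suc N * card F" using F(3) by simp
    finally show ?thesis using F by blast
  next
    case (2 D')
    have D'sub: "D' \<subseteq> Pow {1..N}"
      using 2(1) by (simp add: binary_initial_segment_def boolean_lattice_def)
    have D'down: "downset D'" using 2(1) by (rule binary_initial_segment_downset)
    have cD': "card D' \<le> 2 ^ N"
      using card_mono[OF _ D'sub] by (simp add: card_Pow)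
    have "inj_on (insert (Suc N)) D'"
      using D'sub by (intro inj_onI) (metis Pow_iff Suc_n_not_le_n atLeastAtMost_iff insert_ident subsetD)
    then have cD: "card D = 2 ^ N + card D'"
      unfolding 2(2) using binary_initial_segment_finite[OF 2(1)]
      by (subst card_Un_disjoint) (auto simp: card_Pow card_image)
    obtain F0 where F0: "F0 \<subseteq> D'" "antichain F0"
      "card D' * (N choose (N div 2)) \<le> 2 ^ N * card F0"
      using Suc.IH[OF 2(1)] by blast
    obtain F where F: "F \<subseteq> D'" "antichain F" "\<forall>A\<in>F. card A \<le> N div 2" "card F0 \<le> card F"
      using antichain_push_to_middle[OF _ D'sub D'down F0(1,2), of 0] by auto
    have IH: "card D' * (N choose (N div 2)) \<le> 2 ^ N * card F"
      using F0(3) F(4) by (meson mult_le_mono2 order_trans)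
    \<comment> \<open>\<open>k\<close> is the level of \<open>Pow {1..N}\<close> to be joined with
      the lifted \<open>G\<close>: \<open>j\<close> for \<open>N = 2 * j\<close>, and
      \<open>j + 1\<close> for \<open>N = 2 * j + 1\<close>.\<close>
    have "\<exists>k G. G \<subseteq> D' \<and> antichain G \<and> (\<forall>A\<in>G. card A < k) \<and>
      card D * (Suc N choose (Suc N div 2)) \<le> 2 ^ Suc N * ((N choose k) + card G)"
    proof (cases "even N")
      case True
      then obtain j where j: "N = 2 * j" by blast
      obtain G q s t where G: "G \<subseteq> D'" "antichain G" "\<forall>A\<in>G. card A < j"
        and c: "card F = q + s" "card G = q + t" "j * s \<le> (card {1..N} + 1 - j) * t"
      proof (rule antichain_push_level[OF finite_atLeastAtMost D'sub D'down F(1,2)])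
        show "\<forall>A\<in>F. card A \<le> j" using F(3) j by simp
      qed
      define C M where "C = N choose j" and "M = (2::nat) ^ N"
      \<comment> \<open>With a ground set of size \<open>2 * j\<close> and \<open>r = j\<close>, the
        factor \<open>card V + 1 - r\<close> is \<open>j + 1\<close>.\<close>
      have "j * s \<le> (j + 1) * t" using c(3) j by (simp add: mult_2)
      then have jFG: "j * card F \<le> (j + 1) * card G" using c(1,2) by (simp add: algebra_simps)
      have "j * (card D' * C) \<le> j * (M * card F)"
        using IH j by (intro mult_le_mono2) (simp add: C_def M_def)
      also have "\<dots> = M * (j * card F)" by simp
      also have "\<dots> \<le> M * ((j + 1) * card G)" using jFG by (rule mult_le_mono2)
      finally have 1: "j * (card D' * C) \<le> M * ((j + 1) * card G)" .
      have 3: "card D' * C \<le> M * C" using cD' by (simp add: M_def)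
      \<comment> \<open>The factor \<open>j + 1\<close> makes \<open>central_binomial_odd\<close>
        applicable. Of the \<open>2 * j + 1\<close> copies of \<open>card D' * C\<close>, the
        induction hypothesis pays for \<open>2 * j\<close>, and \<open>card D' \<le> M\<close>
        absorbs the last one, completing \<open>2 * (j + 1)\<close> copies of
        \<open>M * C\<close>.\<close>
      have "(j + 1) * (card D * (Suc N choose (Suc N div 2))) =
          card D * ((j + 1) * ((2 * j + 1) choose j))"
        by (simp add: j algebra_simps)
      also have "\<dots> = (M + card D') * ((2 * j + 1) * C)"
        by (simp only: central_binomial_odd cD C_def M_def j)
      also have "\<dots> = 2 * j * (M * C) + M * C + 2 * (j * (card D' * C)) + card D' * C"
        by (simp add: algebra_simps)
      also have "\<dots> \<le> 2 * j * (M * C) + 2 * (M * C) + 2 * (M * ((j + 1) * card G))"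
        using 1 3 by linarith
      also have "\<dots> = (j + 1) * (2 ^ Suc N * ((N choose j) + card G))"
        by (simp add: C_def M_def algebra_simps)
      finally have "card D * (Suc N choose (Suc N div 2)) \<le> 2 ^ Suc N * ((N choose j) + card G)"
        by (subst (asm) mult_le_cancel1) simp
      then show ?thesis using G by blast
    next
      case False
      then obtain j where j: "N = 2 * j + 1" by (elim oddE)
      \<comment> \<open>Sizes in \<open>F\<close> are at most \<open>j\<close>, already below level
        \<open>j + 1\<close>, so \<open>F\<close> itself serves as \<open>G\<close>. After the exact
        doubling, the required inequality reduces to the induction hypothesis.\<close>
      have "card D * (Suc N choose (Suc N div 2)) = (2 ^ N + card D') * (2 * (N choose (j + 1)))"
        using central_binomial_even[of j] by (simp add: cD j)
      also have "\<dots> \<le> 2 ^ Suc N * ((N choose (j + 1)) + card F)"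
        using IH central_binomial_odd_symmetric[of j] by (simp add: j algebra_simps)
      finally show ?thesis using F j by (intro exI[of _ "j + 1"] exI[of _ F]) force
    qed
    then obtain k G where G: "G \<subseteq> D'" "antichain G" "\<forall>A\<in>G. card A < k"
      "card D * (Suc N choose (Suc N div 2)) \<le> 2 ^ Suc N * ((N choose k) + card G)" by blast
    let ?H = "{A. A \<subseteq> {1..N} \<and> card A = k} \<union> insert (Suc N) ` G"
    have "G \<subseteq> Pow {1..N}" using G(1) D'sub by blast
    then have "antichain ?H" "card ?H = (N choose k) + card G"
      using antichain_level_Un_insert[of "{1..N}" "Suc N" G k] G(2,3) by auto
    moreover have "?H \<subseteq> D" using 2(2) G(1) by blast
    ultimately show ?thesis using G(4) by metis
  qed
qed

theorem theorem7:
  fixes n :: nat and D :: "nat set set"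
  assumes "binary_initial_segment n D" and "D \<noteq> {}"
  shows "real (width D) / real (card D)
           \<ge> real (width (boolean_lattice n)) / real (card (boolean_lattice n))
       \<and> real (width (boolean_lattice n)) / real (card (boolean_lattice n))
           = real (n choose (n div 2)) / 2 ^ n"
proof -
  have fin: "finite D" using assms(1) by (rule binary_initial_segment_finite)
  then have pos: "card D > 0" using assms(2) by (simp add: card_gt_0_iff)
  obtain F where F: "F \<subseteq> D" "antichain F" "card D * (n choose (n div 2)) \<le> 2 ^ n * card F"
    using binary_initial_segment_large_antichain[OF assms(1)] by blast
  have "card D * (n choose (n div 2)) \<le> 2 ^ n * width D"
    using F(3) width_ge[OF fin F(1,2)] by (meson mult_le_mono2 order_trans)
  then have "real (card D * (n choose (n div 2))) \<le> real (2 ^ n * width D)"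
    by (rule of_nat_mono)
  then have "real (n choose (n div 2)) / 2 ^ n \<le> real (width D) / real (card D)"
    using pos by (simp add: field_simps)
  moreover have "card (boolean_lattice n) = 2 ^ n"
    by (simp add: boolean_lattice_def card_Pow)
  ultimately show ?thesis by (simp add: width_boolean_lattice)
qed

end
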